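(* Fix a real number $\rho$ with $0<\rho<1$. Let $A,B,C,D$ be counterclockwise successive vertices of a convex quadrilateral, let $EFGH$ be its inner quadrilateral formed by joining vertices to $\rho$-points, and let $$r=r(\rho,ABCD)=\frac{\text{area}(EFGH)}{\text{area}(ABCD)}.$$ Let $P$ be the point such that $ABCP$ is a parallelogram. Let $C'$ be the point of the line $BC$ lying beyond $C$ (so that $C$ is between $B$ and $C'$) at distance $\rho\cdot BC$ from $C$, and let $C''$ be the point of the line $BC$ lying on the same side of $C$ as $B$, at distance $(1/\rho)\cdot BC$ from $C$. Let $S=\overrightarrow{C'P}\cup\overrightarrow{C''P}$ be the union of the ray from $C'$ through $P$ and the ray from $C''$ through $P$, and let $$S^{*}=S\cap \operatorname{int}(\angle ABC)\cap\operatorname{ext}(\triangle ABC).$$ Then the ratio $r$ is maximal (among the values of $r(\rho,\cdot)$ over all convex quadrilaterals, for this fixed $\rho$) if and only if $D\in S^{*}$. Furthermore, the set of values taken by $r(\rho,ABCD)$ as $ABCD$ ranges over all convex quadrilaterals is exactly the interval $$\left(\frac{(1-\rho)^3}{\rho^2-\rho+1},\ \frac{(1-\rho)^2}{\rho^2+1}\right].$$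
   Context: All figures are in the Euclidean plane. Convex quadrilaterals are nondegenerate (no three vertices collinear). For a convex quadrilateral with vertices $A,B,C,D$ in counterclockwise order and $0<\rho<1$, the $\rho$-point of a side $XY$ (with $Y$ the next vertex after $X$ counterclockwise) is the point $X+\rho(Y-X)$. Let $N_1,N_2,N_3,N_4$ be the $\rho$-points of $BC$, $CD$, $DA$, $AB$ respectively. Draw the segments $AN_1$, $BN_2$, $CN_3$, $DN_4$. The inner quadrilateral $EFGH$ is the one with vertices $E=AN_1\cap BN_2$, $F=BN_2\cap CN_3$, $G=CN_3\cap DN_4$, $H=DN_4\cap AN_1$. In distance expressions, $BC$ denotes the length of segment $BC$. $\operatorname{int}(\angle ABC)$ is the open convex angular region with vertex $B$ bounded by the rays from $B$ through $A$ and from $B$ through $C$; $\operatorname{ext}(\triangle ABC)$ is the complement of the closed triangular region with vertices $A,B,C$. *)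

theory Defs
  imports "HOL-Analysis.Analysis"
begin

type_synonym point = "real ^ 2"

text \<open>Twice the signed area of the triangle \<open>X Y Z\<close>; positive iff \<open>X, Y, Z\<close> is a
  counterclockwise triple of noncollinear points.\<close>

definition orient :: "point \<Rightarrow> point \<Rightarrow> point \<Rightarrow> real" where
  "orient X Y Z = (Y $ 1 - X $ 1) * (Z $ 2 - X $ 2) - (Y $ 2 - X $ 2) * (Z $ 1 - X $ 1)"

text \<open>Every triple of vertices, taken in cyclic order, is noncollinear and counterclockwise;
  equivalently, both remaining vertices lie strictly to the left of each directed side. So
  \<open>A, B, C, D\<close> are the successive counterclockwise vertices of a nondegenerate convex
  quadrilateral.\<close>

definition convex_quad :: "point \<Rightarrow> point \<Rightarrow> point \<Rightarrow> point \<Rightarrow> bool" where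
  "convex_quad A B C D \<longleftrightarrow>
     orient A B C > 0 \<and> orient B C D > 0 \<and> orient C D A > 0 \<and> orient D A B > 0"

definition rho_point :: "real \<Rightarrow> point \<Rightarrow> point \<Rightarrow> point" where
  "rho_point \<rho> X Y = X + \<rho> *\<^sub>R (Y - X)"

text \<open>Meaningful only if the two segments have exactly one common point, as the segments
  below do whenever the quadrilateral is convex and \<open>0 < \<rho> < 1\<close>.\<close>

definition seg_meet :: "point \<Rightarrow> point \<Rightarrow> point \<Rightarrow> point \<Rightarrow> point" where
  "seg_meet U V X Y = (THE Z. Z \<in> closed_segment U V \<inter> closed_segment X Y)"

text \<open>The region bounded by a quadrilateral whose vertices are in convex position is the convex
  hull of its vertices. This applies to the inner quadrilateral as well: along \<open>A N1\<close> the points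
  come in the order \<open>A, H, E, N1\<close>, and cyclically for the other three segments, so each side of
  \<open>EFGH\<close> has the other two vertices strictly on one side.\<close>

definition quad_area :: "point \<Rightarrow> point \<Rightarrow> point \<Rightarrow> point \<Rightarrow> real" where
  "quad_area A B C D = measure lebesgue (convex hull {A, B, C, D})"

definition inner_area :: "real \<Rightarrow> point \<Rightarrow> point \<Rightarrow> point \<Rightarrow> point \<Rightarrow> real" where
  "inner_area \<rho> A B C D =
     (let N1 = rho_point \<rho> B C; N2 = rho_point \<rho> C D;
          N3 = rho_point \<rho> D A; N4 = rho_point \<rho> A B;
          E = seg_meet A N1 B N2; F = seg_meet B N2 C N3;
          G = seg_meet C N3 D N4; H = seg_meet D N4 A N1
      in quad_area E F G H)"

definition area_ratio :: "real \<Rightarrow> point \<Rightarrow> point \<Rightarrow> point \<Rightarrow> point \<Rightarrow> real" where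
  "area_ratio \<rho> A B C D = inner_area \<rho> A B C D / quad_area A B C D"

definition ray :: "point \<Rightarrow> point \<Rightarrow> point set" where
  "ray X Y = {X + t *\<^sub>R (Y - X) | t. 0 \<le> t}"

definition int_angle :: "point \<Rightarrow> point \<Rightarrow> point \<Rightarrow> point set" where
  "int_angle A B C = {B + s *\<^sub>R (A - B) + t *\<^sub>R (C - B) | s t. 0 < s \<and> 0 < t}"

definition ext_triangle :: "point \<Rightarrow> point \<Rightarrow> point \<Rightarrow> point set" where
  "ext_triangle A B C = - (convex hull {A, B, C})"

text \<open>\<open>P\<close> completes the parallelogram \<open>A B C P\<close>. The points \<open>C1\<close> and \<open>C2\<close> lie on the line
  \<open>BC\<close> at distances \<open>\<rho> BC\<close> and \<open>(1/\<rho>) BC\<close> from \<open>C\<close>, on the side of \<open>C\<close> away from \<open>B\<close> and on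
  the side of \<open>B\<close> respectively.\<close>

definition S_star :: "real \<Rightarrow> point \<Rightarrow> point \<Rightarrow> point \<Rightarrow> point set" where
  "S_star \<rho> A B C =
     (let P = A + (C - B);
          C1 = C + \<rho> *\<^sub>R (C - B);
          C2 = C + (1 / \<rho>) *\<^sub>R (B - C)
      in (ray C1 P \<union> ray C2 P) \<inter> int_angle A B C \<inter> ext_triangle A B C)"

end

theory Submission
  imports Defs
begin

text \<open>
  Put \<open>a = orient D A B\<close>, \<open>b = orient A B C\<close>, \<open>c = orient B C D\<close>, \<open>d = orient C D A\<close>, so that
  \<open>a + c = b + d\<close> is twice the area of \<open>ABCD\<close>. Removing the pinwheel of triangles \<open>ABE\<close>, \<open>BCF\<close>,
  \<open>CDG\<close>, \<open>DAH\<close> from \<open>ABCD\<close> leaves \<open>EFGH\<close>, which gives \<open>r = 1 - 2\<rho> + \<rho>\<^sup>3 \<Sigma> / (a + c)\<close>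
  with \<open>\<Sigma>\<close> the sum of the four cyclic shifts of \<open>b c / \<kappa>\<close>, where
  \<open>\<kappa> = (1 - \<rho>) b + \<rho> a + \<rho>\<^sup>2 c\<close> is the cross product of two consecutive cevians.

  Opposite values of \<open>\<kappa>\<close> add up to \<open>(\<rho>\<^sup>2 + 1) (a + c)\<close>. Pairing opposite terms shows that \<open>r\<close> falls
  short of the upper bound by a positive multiple of the square of
  \<open>((1 + \<rho>) b - a - \<rho> c) (c - \<rho> a - (1 - \<rho>) b)\<close>; the two factors are the equations of the lines
  \<open>C'P\<close> and \<open>C''P\<close>. The lower bound is Jensen's inequality for \<open>1/x\<close> at the four values of \<open>\<kappa>\<close>
  with weights \<open>b c\<close>, \<open>c d\<close>, \<open>d a\<close>, \<open>a b\<close>, and a family of trapezoids, on which \<open>r\<close> varies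
  continuously, attains every value of the interval.
\<close>

section \<open>Signed areas and the affine dependence of four points\<close>

lemma orient_cycle: "orient Y Z X = orient X Y Z"
  by (simp add: orient_def algebra_simps)

lemma orient_sum: "orient D A B + orient B C D = orient A B C + orient C D A"
  by (simp add: orient_def algebra_simps)

lemma convex_quad_cycle: "convex_quad A B C D \<Longrightarrow> convex_quad B C D A"
  by (auto simp: convex_quad_def)

lemma point_eq_iff: "(X::point) = Y \<longleftrightarrow> X $ 1 = Y $ 1 \<and> X $ 2 = Y $ 2"
  by (simp add: vec_eq_iff forall_2)

text \<open>Cramer's rule in the plane. Together with \<open>orient_sum\<close> this is the affine
  dependence among the four vertices.\<close>

lemma orient_relation:
  "orient B C D *\<^sub>R A + orient D A B *\<^sub>R C = orient C D A *\<^sub>R B + orient A B C *\<^sub>R D"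
  by (simp add: point_eq_iff orient_def algebra_simps)

lemma orient_affine:
  assumes "u + v + w = 1"
  shows "orient X Y (u *\<^sub>R P + v *\<^sub>R Q + w *\<^sub>R R) = u * orient X Y P + v * orient X Y Q + w * orient X Y R"
proof -
  have u: "u = 1 - v - w" using assms by simp
  show ?thesis unfolding u by (simp add: orient_def algebra_simps)
qed

lemma orient_same [simp]: "orient X Y X = 0" "orient X Y Y = 0" "orient X X Y = 0"
  by (simp_all add: orient_def)

section \<open>Area of a convex quadrilateral\<close>

lemma triangle_area: "measure lebesgue (convex hull {A, B, C :: point}) = \<bar>orient A B C\<bar> / 2"
proof -
  have "closed (convex hull {A, B, C})"
    by (intro compact_imp_closed finite_imp_compact_convex_hull) auto
  then have "measure lebesgue (convex hull {A, B, C}) = measure lborel (convex hull {A, B, C})"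
    by (intro measure_completion) auto
  also have "\<dots> = \<bar>orient A B C\<bar> / 2"
    unfolding content_triangle orient_def
    by (subst abs_minus_commute) (simp add: mult.commute)
  finally show ?thesis .
qed

lemma quad_hull_eq:
  assumes "convex_quad A B C D"
  shows "convex hull {A, B, C, D} = convex hull {A, B, C} \<union> convex hull {A, C, D}"
proof
  show "convex hull {A, B, C} \<union> convex hull {A, C, D} \<subseteq> convex hull {A, B, C, D}"
    by (intro Un_least hull_mono) auto
next
  define a b c d where
    abcd: "a = orient D A B" "b = orient A B C" "c = orient B C D" "d = orient C D A"
  have pos: "a > 0" "b > 0" "c > 0" "d > 0" using assms by (auto simp: convex_quad_def abcd)
  have sum: "a + c = b + d" using orient_sum[of D A B C] by (simp add: abcd)
  have rel: "c *\<^sub>R A + a *\<^sub>R C - d *\<^sub>R B - b *\<^sub>R D = 0"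
    using orient_relation[of B C D A] by (simp add: abcd)
  show "convex hull {A, B, C, D} \<subseteq> convex hull {A, B, C} \<union> convex hull {A, C, D}"
  proof
    fix p assume "p \<in> convex hull {A, B, C, D}"
    also have "{A, B, C, D} = insert D {A, B, C}" by auto
    finally obtain t x where t: "0 \<le> t" "t \<le> 1" and x: "x \<in> convex hull {A, B, C}"
      and p: "p = (1 - t) *\<^sub>R D + t *\<^sub>R x"
      by (auto simp: convex_hull_insert_alt[of D])
    from x obtain u v w where uvw: "0 \<le> u" "0 \<le> v" "0 \<le> w" "u + v + w = 1"
      and x: "x = u *\<^sub>R A + v *\<^sub>R B + w *\<^sub>R C"
      by (auto simp: convex_hull_3)
    define \<alpha> \<beta> \<gamma> \<delta> where coef: "\<alpha> = t * u" "\<beta> = t * v" "\<gamma> = t * w" "\<delta> = 1 - t"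
    have nonneg: "\<alpha> \<ge> 0" "\<beta> \<ge> 0" "\<gamma> \<ge> 0" "\<delta> \<ge> 0" using t uvw by (auto simp: coef)
    have "\<alpha> + \<beta> + \<gamma> = t * (u + v + w)" by (simp add: coef algebra_simps)
    then have one: "\<alpha> + \<beta> + \<gamma> + \<delta> = 1" using uvw by (simp add: coef)
    have p: "p = \<alpha> *\<^sub>R A + \<beta> *\<^sub>R B + \<gamma> *\<^sub>R C + \<delta> *\<^sub>R D"
      unfolding p x coef by (simp add: algebra_simps)
    \<comment> \<open>Shift weight from \<open>B\<close> and \<open>D\<close> to \<open>A\<close> and \<open>C\<close> until the weight of \<open>B\<close> or of \<open>D\<close> vanishes.\<close>
    have move: "p = (\<alpha> + l * c) *\<^sub>R A + (\<beta> - l * d) *\<^sub>R B + (\<gamma> + l * a) *\<^sub>R C + (\<delta> - l * b) *\<^sub>R D" for l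
    proof -
      have "p = p + l *\<^sub>R (c *\<^sub>R A + a *\<^sub>R C - d *\<^sub>R B - b *\<^sub>R D)" by (simp add: rel)
      then show ?thesis unfolding p by (simp add: algebra_simps)
    qed
    have weights: "(\<alpha> + l * c) + (\<beta> - l * d) + (\<gamma> + l * a) + (\<delta> - l * b) = 1" for l
    proof -
      have "(\<alpha> + l * c) + (\<beta> - l * d) + (\<gamma> + l * a) + (\<delta> - l * b) = 1 + l * ((a + c) - (b + d))"
        using one by (simp add: algebra_simps)
      then show ?thesis using sum by simp
    qed
    show "p \<in> convex hull {A, B, C} \<union> convex hull {A, C, D}"
    proof (cases "\<beta> * b \<le> \<delta> * d")
      case True
      \<comment> \<open>The shift at which the weight of \<open>B\<close> vanishes; the case
        condition keeps the weight of \<open>D\<close> nonnegative.\<close>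
      define l where "l = \<beta> / d"
      have l: "l \<ge> 0" "\<beta> - l * d = 0" "\<delta> - l * b \<ge> 0"
        using True pos nonneg by (auto simp: l_def field_simps)
      have "p = (\<alpha> + l * c) *\<^sub>R A + (\<gamma> + l * a) *\<^sub>R C + (\<delta> - l * b) *\<^sub>R D"
        using move[of l] l by simp
      moreover have "\<alpha> + l * c \<ge> 0" "\<gamma> + l * a \<ge> 0" using l nonneg pos by auto
      moreover have "(\<alpha> + l * c) + (\<gamma> + l * a) + (\<delta> - l * b) = 1" using weights[of l] l by simp
      ultimately have "p \<in> convex hull {A, C, D}" using l unfolding convex_hull_3 by blast
      then show ?thesis by simp
    next
      case False
      define l where "l = \<delta> / b"
      have l: "l \<ge> 0" "\<delta> - l * b = 0" "\<beta> - l * d \<ge> 0"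
        using False pos nonneg by (auto simp: l_def field_simps)
      have "p = (\<alpha> + l * c) *\<^sub>R A + (\<beta> - l * d) *\<^sub>R B + (\<gamma> + l * a) *\<^sub>R C"
        using move[of l] l by simp
      moreover have "\<alpha> + l * c \<ge> 0" "\<gamma> + l * a \<ge> 0" using l nonneg pos by auto
      moreover have "(\<alpha> + l * c) + (\<beta> - l * d) + (\<gamma> + l * a) = 1" using weights[of l] l by simp
      ultimately have "p \<in> convex hull {A, B, C}" using l unfolding convex_hull_3 by blast
      then show ?thesis by simp
    qed
  qed
qed

lemma negligible_line:
  assumes "(A::point) \<noteq> C"
  shows "negligible {p. orient A C p = 0}"
proof -
  define n :: point where "n = (\<chi> i. if i = 1 then - (C $ 2 - A $ 2) else C $ 1 - A $ 1)"
  have n: "n $ 1 = - (C $ 2 - A $ 2)" "n $ 2 = C $ 1 - A $ 1" by (simp_all add: n_def)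
  have "n \<noteq> 0" using assms n by (auto simp: point_eq_iff)
  moreover have "orient A C p = 0 \<longleftrightarrow> n \<bullet> p = n \<bullet> A" for p
    by (simp add: orient_def inner_vec_def sum_2 n algebra_simps)
  ultimately show ?thesis using negligible_hyperplane[of n] by simp
qed

text \<open>The line \<open>A C\<close> separates the two triangles, so they overlap only in a null
  set and their areas add up.\<close>

lemma quad_area_eq:
  assumes "convex_quad A B C D"
  shows "quad_area A B C D = (orient A B C + orient C D A) / 2"
proof -
  let ?S = "convex hull {A, B, C}" and ?T = "convex hull {A, C, D}"
  have pos: "orient A B C > 0" "orient C D A > 0"
    using assms by (auto simp: convex_quad_def)
  have cycles: "orient A C B = - orient A B C" "orient A C D = orient C D A"
    by (simp_all add: orient_def algebra_simps)
  have S: "orient A C p \<le> 0" if "p \<in> ?S" for p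
    using that pos cycles by (auto simp: convex_hull_3 orient_affine)
  have T: "orient A C p \<ge> 0" if "p \<in> ?T" for p
    using that pos cycles by (auto simp: convex_hull_3 orient_affine)
  have "A \<noteq> C" using pos by auto
  then have "negligible (?S \<inter> ?T)"
    by (rule negligible_subset[OF negligible_line]) (use S T in force)
  then have "?S \<inter> ?T \<in> null_sets lebesgue" by (simp add: negligible_iff_null_sets)
  then have "measure lebesgue (?S \<inter> ?T) = 0" by (simp add: measure_eq_0_null_sets)
  moreover have "?S \<in> lmeasurable" "?T \<in> lmeasurable"
    by (auto intro!: lmeasurable_compact finite_imp_compact_convex_hull)
  ultimately have "quad_area A B C D = measure lebesgue ?S + measure lebesgue ?T"
    unfolding quad_area_def quad_hull_eq[OF assms] by (simp add: measure_Un3)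
  then show ?thesis
    using pos cycles by (simp add: triangle_area)
qed

section \<open>Vertices of the inner quadrilateral\<close>

text \<open>The last assumption excludes parallel segments, so the common point is unique and
  \<open>THE\<close> picks it.\<close>

lemma seg_meet_eqI:
  assumes "P = U + a *\<^sub>R (V - U)" "0 \<le> a" "a \<le> 1"
    and "P = X + b *\<^sub>R (Y - X)" "0 \<le> b" "b \<le> 1"
    and "orient 0 (V - U) (Y - X) \<noteq> 0"
  shows "seg_meet U V X Y = P"
  unfolding seg_meet_def
proof (rule the_equality)
  show "P \<in> closed_segment U V \<inter> closed_segment X Y"
    using assms(1-6) by (force simp: closed_segment_def algebra_simps)
next
  fix Q assume "Q \<in> closed_segment U V \<inter> closed_segment X Y"
  then obtain s t where st: "Q = (1 - s) *\<^sub>R U + s *\<^sub>R V" "Q = (1 - t) *\<^sub>R X + t *\<^sub>R Y"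
    unfolding closed_segment_def by blast
  have Q: "Q = U + s *\<^sub>R (V - U)" using st(1) by (simp add: algebra_simps)
  have Q': "Q = X + t *\<^sub>R (Y - X)" using st(2) by (simp add: algebra_simps)
  have "(s - a) *\<^sub>R (V - U) = Q - P" unfolding Q assms(1) by (simp add: algebra_simps)
  also have "\<dots> = (t - b) *\<^sub>R (Y - X)" unfolding Q' assms(4) by (simp add: algebra_simps)
  \<comment> \<open>The cross product with \<open>Y - X\<close> kills the right-hand side and
    isolates \<open>s - a\<close>.\<close>
  finally have "orient 0 ((s - a) *\<^sub>R (V - U)) (Y - X) = orient 0 ((t - b) *\<^sub>R (Y - X)) (Y - X)"
    by simp
  then have "(s - a) * orient 0 (V - U) (Y - X) = 0"
    by (simp add: orient_def algebra_simps)
  then have "s = a" using assms(7) by simp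
  then show "Q = P" using Q assms(1) by simp
qed

text \<open>The arguments stand for twice the areas of the triangles cut off at \<open>A\<close>,
  \<open>B\<close>, \<open>C\<close>. With them this is the cross product in
  \<open>orient_cevians\<close>, and cyclic shifts serve the other three pairs of cevians.\<close>

definition cevian_cross :: "real \<Rightarrow> real \<Rightarrow> real \<Rightarrow> real \<Rightarrow> real" where
  "cevian_cross \<rho> x y z = (1 - \<rho>) * y + \<rho> * x + \<rho>\<^sup>2 * z"

lemma cevian_cross_pos:
  assumes "0 < \<rho>" "\<rho> < 1" "0 \<le> x" "0 \<le> y" "0 \<le> z" "0 < x + y + z"
  shows "0 < cevian_cross \<rho> x y z"
proof -
  have "0 \<le> (1 - \<rho>) * y" "0 \<le> \<rho> * x" "0 \<le> \<rho>\<^sup>2 * z" using assms by auto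
  moreover have "(1 - \<rho>) * y > 0 \<or> \<rho> * x > 0 \<or> \<rho>\<^sup>2 * z > 0"
    using assms by (auto simp: zero_less_mult_iff)
  ultimately show ?thesis unfolding cevian_cross_def by linarith
qed

lemma orient_cevians:
  "orient 0 (rho_point \<rho> B C - A) (rho_point \<rho> C D - B)
     = cevian_cross \<rho> (orient D A B) (orient A B C) (orient B C D)"
  by (simp add: orient_def rho_point_def cevian_cross_def algebra_simps power2_eq_square)

text \<open>Both parameters come from Cramer's rule. Each cevian carries two inner vertices, so
  every vertex is located along both of its cevians.\<close>

lemma inner_vertex:
  fixes A B C D :: point
  assumes "convex_quad A B C D" and \<rho>: "0 < \<rho>" "\<rho> < 1"
  defines "N1 \<equiv> rho_point \<rho> B C" and "N2 \<equiv> rho_point \<rho> C D"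
    and "k \<equiv> cevian_cross \<rho> (orient D A B) (orient A B C) (orient B C D)"
  shows "seg_meet A N1 B N2 = B + (\<rho> * orient A B C / k) *\<^sub>R (N2 - B)" (is "_ = ?P")
    and "seg_meet A N1 B N2 = A + (1 - \<rho>\<^sup>2 * orient B C D / k) *\<^sub>R (N1 - A)" (is "_ = ?Q")
proof -
  have pos: "orient D A B > 0" "orient A B C > 0" "orient B C D > 0"
    using assms(1) by (auto simp: convex_quad_def)
  then have k: "k > 0" unfolding k_def using \<rho> by (auto intro!: cevian_cross_pos)
  \<comment> \<open>The intersection equation cleared of the denominator \<open>k\<close>, hence a
    polynomial identity.\<close>
  have "k *\<^sub>R B + (\<rho> * orient A B C) *\<^sub>R (N2 - B) = k *\<^sub>R A + (k - \<rho>\<^sup>2 * orient B C D) *\<^sub>R (N1 - A)"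
    unfolding k_def cevian_cross_def N1_def N2_def rho_point_def point_eq_iff orient_def
    by (simp add: algebra_simps power2_eq_square)
  then have "(1 / k) *\<^sub>R (k *\<^sub>R B + (\<rho> * orient A B C) *\<^sub>R (N2 - B)) =
      (1 / k) *\<^sub>R (k *\<^sub>R A + (k - \<rho>\<^sup>2 * orient B C D) *\<^sub>R (N1 - A))" by simp
  then have PQ: "?P = ?Q"
    using k by (simp add: scaleR_add_right diff_divide_distrib)
  have d: "orient C D A > 0" using assms(1) by (simp add: convex_quad_def)
  \<comment> \<open>Expanded directly, \<open>orient A B C\<close> has coefficient
    \<open>1 - 2 * \<rho>\<close>, which may be negative. Trading \<open>orient B C D\<close> for
    the other three areas makes every coefficient nonnegative.\<close>
  have "k - \<rho> * orient A B C
      = (1 - \<rho>)\<^sup>2 * orient A B C + \<rho> * (1 - \<rho>) * orient D A B + \<rho>\<^sup>2 * orient C D A"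
    unfolding k_def cevian_cross_def orient_def by (simp add: algebra_simps power2_eq_square)
  also have "\<dots> \<ge> 0" using pos d \<rho> by simp
  finally have "\<rho> * orient A B C \<le> k" by simp
  moreover have "\<rho>\<^sup>2 * orient B C D \<le> k"
    unfolding k_def cevian_cross_def using pos \<rho> by simp
  ultimately have bounds: "0 \<le> \<rho> * orient A B C" "\<rho> * orient A B C \<le> k"
      "0 \<le> \<rho>\<^sup>2 * orient B C D" "\<rho>\<^sup>2 * orient B C D \<le> k"
    using pos \<rho> by simp_all
  show "seg_meet A N1 B N2 = ?P"
  proof (rule seg_meet_eqI[OF PQ _ _ refl])
    show "orient 0 (N1 - A) (N2 - B) \<noteq> 0"
      using k orient_cevians unfolding N1_def N2_def k_def by simp
  qed (use bounds k in auto)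
  then show "seg_meet A N1 B N2 = ?Q" using PQ by simp
qed

text \<open>By \<open>inner_vertex\<close> the two sides are the parameters of \<open>E\<close> and
  \<open>F\<close> along \<open>B N2\<close>, so this fixes the order of the inner vertices on each
  cevian. Once denominators are cleared, the difference is a sum of positive terms.\<close>

lemma inner_parameters_less:
  fixes \<rho> a b c d :: real
  assumes "0 < \<rho>" "\<rho> < 1" "0 < a" "0 < b" "0 < c" "0 < d" and sum: "a + c = b + d"
  shows "\<rho> * b / cevian_cross \<rho> a b c < 1 - \<rho>\<^sup>2 * d / cevian_cross \<rho> b c d"
proof -
  let ?k = "cevian_cross \<rho> a b c" and ?l = "cevian_cross \<rho> b c d"
  have kl: "?k > 0" "?l > 0" using assms by (auto intro: cevian_cross_pos)
  have d: "d = a + c - b" using sum by simp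
  have "?k * ?l - \<rho>\<^sup>2 * d * ?k - \<rho> * b * ?l
      = (1 - \<rho>) * (\<rho> * (1 - \<rho>) * b\<^sup>2 + (1 - \<rho>)\<^sup>2 * (b * c) + \<rho>\<^sup>2 * (a * b)
          + \<rho> * (1 - \<rho>) * (a * c) + \<rho>\<^sup>2 * (c * d))"
    unfolding cevian_cross_def d by (simp add: algebra_simps power2_eq_square)
  also have "\<dots> > 0" using assms by (intro mult_pos_pos add_pos_pos) auto
  finally show ?thesis using kl by (simp add: field_simps)
qed

section \<open>Area of the inner quadrilateral\<close>

text \<open>Consecutive inner sides run along consecutive cevians, so a corner is a multiple of
  their cross product, and the order of points on the cevians decides its sign.\<close>

lemma orient_corner:
  assumes "E = B + v *\<^sub>R (N - B)" "F = B + w *\<^sub>R (N - B)"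
    and "F = C + v' *\<^sub>R (N' - C)" "G = C + w' *\<^sub>R (N' - C)"
  shows "orient E F G = (w - v) * (w' - v') * orient 0 (N - B) (N' - C)"
proof -
  have 1: "F - E = (w - v) *\<^sub>R (N - B)" unfolding assms(1,2) by (simp add: algebra_simps)
  have 2: "G - F = (w' - v') *\<^sub>R (N' - C)" unfolding assms(3,4) by (simp add: algebra_simps)
  have "orient E F G = orient 0 (F - E) (G - F)"
    by (simp add: orient_def algebra_simps)
  then show ?thesis unfolding 1 2 by (simp add: orient_def algebra_simps)
qed

text \<open>Shoelace cancellation: the boundaries of the four outer triangles and of
  \<open>EFGH\<close> add up to that of \<open>ABCD\<close> plus the boundaries of the four
  triangles in the assumptions, which are degenerate.\<close>

lemma pinwheel:
  assumes "orient A H E = 0" "orient B E F = 0" "orient C F G = 0" "orient D G H = 0"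
  shows "orient E F G + orient G H E = orient A B C + orient C D A
    - (orient A B E + orient B C F + orient C D G + orient D A H)"
  using assms unfolding orient_def by (simp add: algebra_simps)

definition cyclic_sum :: "real \<Rightarrow> real \<Rightarrow> real \<Rightarrow> real \<Rightarrow> real \<Rightarrow> real" where
  "cyclic_sum \<rho> a b c d =
     b * c / cevian_cross \<rho> a b c + c * d / cevian_cross \<rho> b c d +
     d * a / cevian_cross \<rho> c d a + a * b / cevian_cross \<rho> d a b"

lemma inner_area_eq:
  fixes A B C D :: point
  assumes quad: "convex_quad A B C D" and \<rho>: "0 < \<rho>" "\<rho> < 1"
  defines "a \<equiv> orient D A B" and "b \<equiv> orient A B C" and "c \<equiv> orient B C D" and "d \<equiv> orient C D A"
  shows "inner_area \<rho> A B C D = ((1 - 2 * \<rho>) * (a + c) + \<rho> ^ 3 * cyclic_sum \<rho> a b c d) / 2"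
proof -
  have pos: "a > 0" "b > 0" "c > 0" "d > 0"
    using quad by (auto simp: convex_quad_def a_def b_def c_def d_def)
  have sum: "a + c = b + d" unfolding a_def b_def c_def d_def by (rule orient_sum)
  define N1 N2 N3 N4 where N: "N1 = rho_point \<rho> B C" "N2 = rho_point \<rho> C D"
    "N3 = rho_point \<rho> D A" "N4 = rho_point \<rho> A B"
  define E F G H where EFGH: "E = seg_meet A N1 B N2" "F = seg_meet B N2 C N3"
    "G = seg_meet C N3 D N4" "H = seg_meet D N4 A N1"
  note quads = quad quad[THEN convex_quad_cycle] quad[THEN convex_quad_cycle, THEN convex_quad_cycle]
    quad[THEN convex_quad_cycle, THEN convex_quad_cycle, THEN convex_quad_cycle]
  note E = inner_vertex[OF quads(1) \<rho>, folded a_def b_def c_def d_def N, folded EFGH]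
  note F = inner_vertex[OF quads(2) \<rho>, folded a_def b_def c_def d_def N, folded EFGH]
  note G = inner_vertex[OF quads(3) \<rho>, folded a_def b_def c_def d_def N, folded EFGH]
  note H = inner_vertex[OF quads(4) \<rho>, folded a_def b_def c_def d_def N, folded EFGH]
  note cross = orient_cevians[of \<rho> B C A D, folded a_def b_def c_def d_def N]
    orient_cevians[of \<rho> C D B A, folded a_def b_def c_def d_def N]
    orient_cevians[of \<rho> D A C B, folded a_def b_def c_def d_def N]
    orient_cevians[of \<rho> A B D C, folded a_def b_def c_def d_def N]
  note less = inner_parameters_less[OF \<rho> pos sum]
    inner_parameters_less[OF \<rho> pos(2,3,4,1)] inner_parameters_less[OF \<rho> pos(3,4,1,2)]
    inner_parameters_less[OF \<rho> pos(4,1,2,3)]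
  have dens: "cevian_cross \<rho> a b c > 0" "cevian_cross \<rho> b c d > 0"
      "cevian_cross \<rho> c d a > 0" "cevian_cross \<rho> d a b > 0"
    using pos \<rho> by (auto intro: cevian_cross_pos)
  \<comment> \<open>Positive corners make \<open>EFGH\<close> a convex quadrilateral, so
    \<open>quad_area_eq\<close> applies to it as well.\<close>
  have "orient E F G > 0" "orient F G H > 0" "orient G H E > 0" "orient H E F > 0"
    unfolding orient_corner[OF E(1) F(2) F(1) G(2)] orient_corner[OF F(1) G(2) G(1) H(2)]
      orient_corner[OF G(1) H(2) H(1) E(2)] orient_corner[OF H(1) E(2) E(1) F(2)] cross
    using less sum dens by (auto intro!: mult_pos_pos)
  then have "convex_quad E F G H" by (simp add: convex_quad_def)
  then have area: "inner_area \<rho> A B C D = (orient E F G + orient G H E) / 2"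
    unfolding inner_area_def Let_def N[symmetric] EFGH[symmetric] by (rule quad_area_eq)
  have collinear: "orient X (X + s *\<^sub>R (Y - X)) (X + t *\<^sub>R (Y - X)) = 0" for X Y :: point and s t
    by (simp add: orient_def algebra_simps)
  have "orient A H E = 0" unfolding H(1) E(2) by (rule collinear)
  moreover have "orient B E F = 0" unfolding E(1) F(2) by (rule collinear)
  moreover have "orient C F G = 0" unfolding F(1) G(2) by (rule collinear)
  moreover have "orient D G H = 0" unfolding G(1) H(2) by (rule collinear)
  ultimately have pin: "orient E F G + orient G H E =
      b + d - (orient A B E + orient B C F + orient C D G + orient D A H)"
    unfolding b_def d_def by (rule pinwheel)
  \<comment> \<open>The factor \<open>cevian_cross \<rho> x y z - \<rho>\<^sup>2 * z\<close> is
    \<open>orient X Y\<close> of the far end of the cevian; scaling it by the parameter of the inner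
    vertex produces the terms of \<open>cyclic_sum\<close>.\<close>
  have triangle: "orient X Y (Y + (\<rho> * y / cevian_cross \<rho> x y z) *\<^sub>R (rho_point \<rho> Z W - Y))
      = \<rho> * y - \<rho> ^ 3 * (y * z / cevian_cross \<rho> x y z)"
    if "x = orient W X Y" "y = orient X Y Z" "cevian_cross \<rho> x y z > 0" for X Y Z W :: point and x y z
  proof -
    have step: "orient X Y (Y + v *\<^sub>R (rho_point \<rho> Z W - Y)) = v * (cevian_cross \<rho> x y z - \<rho>\<^sup>2 * z)" for v
      unfolding that(1,2) cevian_cross_def rho_point_def orient_def by (simp add: algebra_simps)
    show ?thesis
      unfolding step using that(3) by (simp add: field_simps power2_eq_square power3_eq_cube)
  qed
  have "orient A B E = \<rho> * b - \<rho> ^ 3 * (b * c / cevian_cross \<rho> a b c)"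
    unfolding E(1) N by (rule triangle) (use dens in \<open>simp_all add: a_def b_def\<close>)
  moreover have "orient B C F = \<rho> * c - \<rho> ^ 3 * (c * d / cevian_cross \<rho> b c d)"
    unfolding F(1) N by (rule triangle) (use dens in \<open>simp_all add: b_def c_def\<close>)
  moreover have "orient C D G = \<rho> * d - \<rho> ^ 3 * (d * a / cevian_cross \<rho> c d a)"
    unfolding G(1) N by (rule triangle) (use dens in \<open>simp_all add: c_def d_def\<close>)
  moreover have "orient D A H = \<rho> * a - \<rho> ^ 3 * (a * b / cevian_cross \<rho> d a b)"
    unfolding H(1) N by (rule triangle) (use dens in \<open>simp_all add: d_def a_def\<close>)
  \<comment> \<open>The linear terms of the four triangles then total
    \<open>2 * \<rho> * (a + c)\<close>.\<close>
  moreover have "\<rho> * a + \<rho> * c = \<rho> * b + \<rho> * d" by (metis distrib_left sum)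
  ultimately have "orient E F G + orient G H E = (1 - 2 * \<rho>) * (a + c) + \<rho> ^ 3 * cyclic_sum \<rho> a b c d"
    using pin sum by (simp add: cyclic_sum_def algebra_simps)
  then show ?thesis using area by simp
qed

lemma area_ratio_eq:
  fixes A B C D :: point
  assumes quad: "convex_quad A B C D" and \<rho>: "0 < \<rho>" "\<rho> < 1"
  defines "a \<equiv> orient D A B" and "b \<equiv> orient A B C" and "c \<equiv> orient B C D" and "d \<equiv> orient C D A"
  shows "area_ratio \<rho> A B C D = 1 - 2 * \<rho> + \<rho> ^ 3 * (cyclic_sum \<rho> a b c d / (a + c))"
proof -
  have "a + c = b + d" unfolding a_def b_def c_def d_def by (rule orient_sum)
  then have "quad_area A B C D = (a + c) / 2"
    using quad_area_eq[OF quad] by (simp add: b_def d_def)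
  moreover have "inner_area \<rho> A B C D = ((1 - 2 * \<rho>) * (a + c) + \<rho> ^ 3 * cyclic_sum \<rho> a b c d) / 2"
    using inner_area_eq[OF quad \<rho>] by (simp add: a_def b_def c_def d_def)
  moreover have "a + c > 0" using quad by (auto simp: convex_quad_def a_def c_def)
  ultimately show ?thesis
    unfolding area_ratio_def by (simp add: add_divide_distrib)
qed

section \<open>Bounds for the cyclic sum\<close>

text \<open>Here \<open>p\<close> and \<open>K * T - p\<close> are opposite values of the cross product, and \<open>T = a + c\<close>.\<close>

lemma opposite_terms:
  fixes K T b c p :: real
  assumes "0 < K" "0 < p" "p < K * T"
  shows "b * c / p + (T - b) * (T - c) / (K * T - p)
    = T / K + T * (p - K * b) * (p - K * c) / (K * (p * (K * T - p)))"
proof -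
  have "K \<noteq> 0" "p \<noteq> 0" "K * T - p \<noteq> 0" using assms by auto
  then show ?thesis by (simp add: divide_simps) (simp add: algebra_simps)
qed

lemma cyclic_sum_eq:
  fixes \<rho> a b c d :: real
  assumes \<rho>: "0 < \<rho>" "\<rho> < 1" and pos: "0 < a" "0 < b" "0 < c" "0 < d" and sum: "a + c = b + d"
  shows "cyclic_sum \<rho> a b c d / (a + c) = 2 / (\<rho>\<^sup>2 + 1)
    - \<rho> * (1 - \<rho>)\<^sup>2 * (((1 + \<rho>) * b - a - \<rho> * c) * (c - \<rho> * a - (1 - \<rho>) * b))\<^sup>2
      / ((\<rho>\<^sup>2 + 1) * (cevian_cross \<rho> a b c * cevian_cross \<rho> c d a * (cevian_cross \<rho> b c d * cevian_cross \<rho> d a b)))"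
proof -
  define K T where KT: "K = \<rho>\<^sup>2 + 1" "T = a + c"
  define p q where pq: "p = cevian_cross \<rho> a b c" "q = cevian_cross \<rho> b c d"
  define m n where mn: "m = (1 + \<rho>) * b - a - \<rho> * c" "n = c - \<rho> * a - (1 - \<rho>) * b"
  have K: "K > 0" unfolding KT by (rule add_nonneg_pos) auto
  have T: "T > 0" using pos KT by simp
  have a: "a = T - c" and d: "d = T - b" using sum by (simp_all add: KT)
  have p': "cevian_cross \<rho> c d a = K * T - p" and q': "cevian_cross \<rho> d a b = K * T - q"
    unfolding pq cevian_cross_def KT(1) a d by (simp_all add: algebra_simps)
  have p: "0 < p" "p < K * T" and q: "0 < q" "q < K * T"
    using cevian_cross_pos[of \<rho> a b c] cevian_cross_pos[of \<rho> c d a]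
      cevian_cross_pos[of \<rho> b c d] cevian_cross_pos[of \<rho> d a b] \<rho> pos
    unfolding p' q' by (auto simp: pq)
  \<comment> \<open>These turn the numerators of \<open>opposite_terms\<close> into multiples of
    \<open>m * n\<close>, with opposite signs for the two pairs.\<close>
  have factors: "p - K * b = - \<rho> * m" "p - K * c = - n" "q - K * c = - \<rho> * n" "q - K * (T - b) = m"
    unfolding pq cevian_cross_def KT(1) mn a d by (simp_all add: algebra_simps power2_eq_square)
  \<comment> \<open>The two pairs differ only in the denominators \<open>P\<close> and
    \<open>Q\<close>. Since \<open>Q - P\<close> is again a multiple of \<open>m * n\<close>, their
    sum contains the square of \<open>m * n\<close>.\<close>
  have "q * (K * T - q) - p * (K * T - p) = (q - p) * (K * T - p - q)"
    by (simp add: algebra_simps)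
  also have "q - p = (1 - \<rho>) * n"
    unfolding pq cevian_cross_def mn a d by (simp add: algebra_simps power2_eq_square)
  also have "K * T - p - q = - ((1 - \<rho>) * m)"
    unfolding pq cevian_cross_def KT(1) mn a d by (simp add: algebra_simps power2_eq_square)
  finally have diff: "q * (K * T - q) = p * (K * T - p) - (1 - \<rho>)\<^sup>2 * m * n"
    by (simp add: algebra_simps power2_eq_square)
  define P Q where PQ: "P = p * (K * T - p)" "Q = q * (K * T - q)"
  have PQ_pos: "P > 0" "Q > 0" using p q by (simp_all add: PQ)
  have "b * c / p + d * a / (K * T - p) = T / K + T * (\<rho> * m * n) / (K * P)"
    using opposite_terms[OF K p, of b c] unfolding factors PQ a d by (simp add: mult_ac)
  moreover have "c * d / q + a * b / (K * T - q) = T / K - T * (\<rho> * m * n) / (K * Q)"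
    using opposite_terms[OF K q, of c d] unfolding factors PQ a d by (simp add: mult_ac)
  ultimately have "cyclic_sum \<rho> a b c d / T
      = (2 * (T / K) + (T * (\<rho> * m * n) / (K * P) - T * (\<rho> * m * n) / (K * Q))) / T"
    unfolding cyclic_sum_def p' q' pq[symmetric] by simp
  also have "\<dots> = 2 / K + \<rho> * m * n * (Q - P) / (K * (P * Q))"
    using K T PQ_pos by (simp add: field_simps)
  also have "Q - P = - ((1 - \<rho>)\<^sup>2 * m * n)" using diff by (simp add: PQ)
  finally show ?thesis
    unfolding p' q' pq[symmetric] mn[symmetric] KT(1)[symmetric] KT(2)[symmetric] PQ
    by (simp add: power2_eq_square mult_ac)
qed

lemma cyclic_sum_greater:
  fixes \<rho> a b c d :: real
  assumes \<rho>: "0 < \<rho>" "\<rho> < 1" and pos: "0 < a" "0 < b" "0 < c" "0 < d" and sum: "a + c = b + d"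
  shows "1 / (\<rho>\<^sup>2 - \<rho> + 1) < cyclic_sum \<rho> a b c d / (a + c)"
proof -
  define J T where JT: "J = \<rho>\<^sup>2 - \<rho> + 1" "T = a + c"
  have "J = (1 - \<rho>)\<^sup>2 + \<rho>" by (simp add: JT power2_eq_square algebra_simps)
  then have J: "J > 0" using \<rho> by (simp add: add_nonneg_pos)
  have T: "T > 0" using pos JT by simp
  have a: "a = T - c" and d: "d = T - b" using sum by (simp_all add: JT)
  \<comment> \<open>The tangent line of \<open>1 / x\<close> at \<open>J * T\<close>, which is the
    one cross product that keeps its weight when \<open>b\<close> and \<open>c\<close> tend to
    0.\<close>
  have tangent: "w * (2 * J * T - D) / (J * T)\<^sup>2 \<le> w / D" if "w > 0" "D > 0" for w D
  proof -
    have "(2 * J * T - D) * D \<le> (J * T)\<^sup>2"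
      using zero_le_power2[of "J * T - D"] by (simp add: power2_eq_square algebra_simps)
    then have "(2 * J * T - D) / (J * T)\<^sup>2 \<le> 1 / D"
      using that J T by (simp add: field_simps)
    then have "w * ((2 * J * T - D) / (J * T)\<^sup>2) \<le> w * (1 / D)"
      using that by (intro mult_left_mono) auto
    then show ?thesis by simp
  qed
  have dens: "cevian_cross \<rho> a b c > 0" "cevian_cross \<rho> b c d > 0"
      "cevian_cross \<rho> c d a > 0" "cevian_cross \<rho> d a b > 0"
    using pos \<rho> by (auto intro!: cevian_cross_pos)
  have "b * c * (2 * J * T - cevian_cross \<rho> a b c) + c * d * (2 * J * T - cevian_cross \<rho> b c d)
      + d * a * (2 * J * T - cevian_cross \<rho> c d a) + a * b * (2 * J * T - cevian_cross \<rho> d a b)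
      = J * T ^ 3 + (1 - \<rho>)\<^sup>2 * (a * b * c + b * c * d + c * d * a + d * a * b)"
    \<comment> \<open>The weights total \<open>(a + c) * (b + d) = T\<^sup>2\<close>; the identity
      says that the weighted mean of the cross products lies below \<open>J * T\<close>, whence
      strictness.\<close>
    unfolding cevian_cross_def JT(1) a d by (simp add: algebra_simps power2_eq_square power3_eq_cube)
  moreover have "0 < (1 - \<rho>)\<^sup>2 * (a * b * c + b * c * d + c * d * a + d * a * b)"
    using \<rho> pos by (intro mult_pos_pos add_pos_pos) auto
  ultimately have "J * T ^ 3 / (J * T)\<^sup>2
      < (b * c * (2 * J * T - cevian_cross \<rho> a b c) + c * d * (2 * J * T - cevian_cross \<rho> b c d)
      + d * a * (2 * J * T - cevian_cross \<rho> c d a) + a * b * (2 * J * T - cevian_cross \<rho> d a b)) / (J * T)\<^sup>2"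
    using J T by (intro divide_strict_right_mono) auto
  also have "\<dots> \<le> cyclic_sum \<rho> a b c d"
    unfolding cyclic_sum_def add_divide_distrib
    using pos dens by (intro add_mono tangent mult_pos_pos)
  finally have "T / J < cyclic_sum \<rho> a b c d"
    using J T by (simp add: power2_eq_square power3_eq_cube)
  then show ?thesis
    using J T unfolding JT(1)[symmetric] JT(2)[symmetric] by (simp add: field_simps)
qed

section \<open>Bounds for the area ratio and the equality case\<close>

lemma upper_bound_eq:
  fixes \<rho> :: real
  shows "1 - 2 * \<rho> + \<rho> ^ 3 * (2 / (\<rho>\<^sup>2 + 1)) = (1 - \<rho>)\<^sup>2 / (\<rho>\<^sup>2 + 1)"
proof -
  have "\<rho>\<^sup>2 + 1 \<noteq> 0" by (metis add_nonneg_pos less_irrefl zero_le_power2 zero_less_one)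
  then show ?thesis by (simp add: field_simps) (simp add: algebra_simps power2_eq_square power3_eq_cube)
qed

lemma lower_bound_eq:
  fixes \<rho> :: real
  assumes "0 < \<rho>"
  shows "1 - 2 * \<rho> + \<rho> ^ 3 * (1 / (\<rho>\<^sup>2 - \<rho> + 1)) = (1 - \<rho>) ^ 3 / (\<rho>\<^sup>2 - \<rho> + 1)"
proof -
  have "\<rho>\<^sup>2 - \<rho> + 1 = (1 - \<rho>)\<^sup>2 + \<rho>" by (simp add: power2_eq_square algebra_simps)
  then have "\<rho>\<^sup>2 - \<rho> + 1 \<noteq> 0" using assms by (metis add_nonneg_pos less_irrefl zero_le_power2)
  then show ?thesis by (simp add: field_simps) (simp add: algebra_simps power2_eq_square power3_eq_cube)
qed

lemma area_ratio_bounds: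
  assumes quad: "convex_quad A B C D" and \<rho>: "0 < \<rho>" "\<rho> < 1"
  shows "(1 - \<rho>) ^ 3 / (\<rho>\<^sup>2 - \<rho> + 1) < area_ratio \<rho> A B C D"
    and "area_ratio \<rho> A B C D \<le> (1 - \<rho>)\<^sup>2 / (\<rho>\<^sup>2 + 1)"
    and "area_ratio \<rho> A B C D = (1 - \<rho>)\<^sup>2 / (\<rho>\<^sup>2 + 1) \<longleftrightarrow>
      orient D A B = (1 + \<rho>) * orient A B C - \<rho> * orient B C D \<or>
      orient B C D = \<rho> * orient D A B + (1 - \<rho>) * orient A B C"
proof -
  define a b c d where
    abcd: "a = orient D A B" "b = orient A B C" "c = orient B C D" "d = orient C D A"
  have pos: "a > 0" "b > 0" "c > 0" "d > 0" using quad by (auto simp: convex_quad_def abcd)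
  have sum: "a + c = b + d" unfolding abcd by (rule orient_sum)
  note ratio = area_ratio_eq[OF quad \<rho>, folded abcd]
  have \<rho>3: "\<rho> ^ 3 > 0" using \<rho> by simp
  show "(1 - \<rho>) ^ 3 / (\<rho>\<^sup>2 - \<rho> + 1) < area_ratio \<rho> A B C D"
    unfolding ratio lower_bound_eq[OF \<rho>(1), symmetric]
    using mult_strict_left_mono[OF cyclic_sum_greater[OF \<rho> pos sum] \<rho>3] by simp
  define m where "m = ((1 + \<rho>) * b - a - \<rho> * c) * (c - \<rho> * a - (1 - \<rho>) * b)"
  define M where "M = (\<rho>\<^sup>2 + 1) * (cevian_cross \<rho> a b c * cevian_cross \<rho> c d a * (cevian_cross \<rho> b c d * cevian_cross \<rho> d a b))"
  have "cevian_cross \<rho> a b c > 0" "cevian_cross \<rho> b c d > 0"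
      "cevian_cross \<rho> c d a > 0" "cevian_cross \<rho> d a b > 0"
    using pos \<rho> by (auto intro!: cevian_cross_pos)
  then have M: "M > 0" unfolding M_def by (intro mult_pos_pos add_nonneg_pos) auto
  have eq: "area_ratio \<rho> A B C D
      = (1 - \<rho>)\<^sup>2 / (\<rho>\<^sup>2 + 1) - \<rho> ^ 3 * (\<rho> * (1 - \<rho>)\<^sup>2 * m\<^sup>2 / M)"
    unfolding ratio upper_bound_eq[symmetric] cyclic_sum_eq[OF \<rho> pos sum] m_def M_def
    by (simp add: right_diff_distrib)
  show "area_ratio \<rho> A B C D \<le> (1 - \<rho>)\<^sup>2 / (\<rho>\<^sup>2 + 1)"
    unfolding eq using \<rho> M by simp
  have "area_ratio \<rho> A B C D = (1 - \<rho>)\<^sup>2 / (\<rho>\<^sup>2 + 1) \<longleftrightarrow> m = 0"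
    unfolding eq using \<rho> M by simp
  also have "\<dots> \<longleftrightarrow> a = (1 + \<rho>) * b - \<rho> * c \<or> c = \<rho> * a + (1 - \<rho>) * b"
    unfolding m_def by auto
  finally show "area_ratio \<rho> A B C D = (1 - \<rho>)\<^sup>2 / (\<rho>\<^sup>2 + 1) \<longleftrightarrow>
      orient D A B = (1 + \<rho>) * orient A B C - \<rho> * orient B C D \<or>
      orient B C D = \<rho> * orient D A B + (1 - \<rho>) * orient A B C"
    unfolding abcd .
qed

section \<open>The locus of maximizing fourth vertices\<close>

text \<open>In the affine frame at \<open>B\<close> with axes \<open>A - B\<close> and
  \<open>C - B\<close>, the point \<open>D\<close> has the positive coordinates \<open>s\<close> and
  \<open>t\<close>. Convexity already places it inside the angle and outside the triangle, so only
  the rays matter.\<close>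

lemma S_star_iff:
  assumes quad: "convex_quad A B C D" and \<rho>: "0 < \<rho>" "\<rho> < 1"
  shows "D \<in> S_star \<rho> A B C \<longleftrightarrow>
      orient D A B = (1 + \<rho>) * orient A B C - \<rho> * orient B C D \<or>
      orient B C D = \<rho> * orient D A B + (1 - \<rho>) * orient A B C"
proof -
  define b s t where "b = orient A B C" "s = orient B C D / b" "t = orient D A B / b"
  note b_def = this(1) and s_def = this(2) and t_def = this(3)
  have pos: "b > 0" "s > 0" "t > 0"
    using quad by (auto simp: convex_quad_def b_def s_def t_def)
  have os: "orient B C D = s * b" and ot: "orient D A B = t * b"
    using pos(1) by (simp_all add: s_def t_def)
  have "orient A B C *\<^sub>R D
      = orient A B C *\<^sub>R B + orient B C D *\<^sub>R (A - B) + orient D A B *\<^sub>R (C - B)"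
    by (simp add: point_eq_iff orient_def algebra_simps)
  then have "b *\<^sub>R D = b *\<^sub>R B + (s * b) *\<^sub>R (A - B) + (t * b) *\<^sub>R (C - B)"
    unfolding os ot b_def[symmetric] .
  also have "\<dots> = b *\<^sub>R (B + s *\<^sub>R (A - B) + t *\<^sub>R (C - B))"
    by (simp add: algebra_simps)
  finally have D: "D = B + s *\<^sub>R (A - B) + t *\<^sub>R (C - B)" using pos(1) by simp
  have coords: "s' = s \<and> t' = t" if "D = B + s' *\<^sub>R (A - B) + t' *\<^sub>R (C - B)" for s' t'
  proof -
    have "orient B C D = s' * b" "orient D A B = t' * b"
      unfolding that b_def by (simp_all add: orient_def algebra_simps)
    then show ?thesis using pos(1) os ot by simp
  qed
  have "D \<in> int_angle A B C" unfolding int_angle_def using D pos by blast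
  moreover have "D \<in> ext_triangle A B C"
  proof -
    have "orient C A D \<ge> 0" if "D \<in> convex hull {A, B, C}"
    proof -
      have "orient C A B > 0" using pos(1) by (simp add: b_def orient_cycle)
      then show ?thesis using that by (auto simp: convex_hull_3 orient_affine)
    qed
    moreover have "orient C A D = - orient C D A" by (simp add: orient_def algebra_simps)
    ultimately show ?thesis using quad by (auto simp: ext_triangle_def convex_quad_def)
  qed
  \<comment> \<open>The ray parameter \<open>l\<close> is the coordinate along \<open>A - B\<close>,
    hence equals \<open>s > 0\<close>, and membership in the ray amounts to membership in its
    line.\<close>
  moreover have "D \<in> ray (C + \<rho> *\<^sub>R (C - B)) (A + (C - B)) \<longleftrightarrow> t = 1 + \<rho> - \<rho> * s"
  proof -
    have "C + \<rho> *\<^sub>R (C - B) + l *\<^sub>R (A + (C - B) - (C + \<rho> *\<^sub>R (C - B)))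
        = B + l *\<^sub>R (A - B) + (1 + \<rho> - \<rho> * l) *\<^sub>R (C - B)" for l
      by (simp add: algebra_simps)
    then show ?thesis unfolding ray_def using coords D pos by fastforce
  qed
  moreover have "D \<in> ray (C + (1 / \<rho>) *\<^sub>R (B - C)) (A + (C - B)) \<longleftrightarrow> t = 1 - 1 / \<rho> + s / \<rho>"
  proof -
    have "C + (1 / \<rho>) *\<^sub>R (B - C) + l *\<^sub>R (A + (C - B) - (C + (1 / \<rho>) *\<^sub>R (B - C)))
        = B + l *\<^sub>R (A - B) + (1 - 1 / \<rho> + l / \<rho>) *\<^sub>R (C - B)" for l
      by (simp add: algebra_simps)
    then show ?thesis unfolding ray_def using coords D pos by fastforce
  qed
  moreover have "t = 1 - 1 / \<rho> + s / \<rho> \<longleftrightarrow> s = \<rho> * t + (1 - \<rho>)"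
    using \<rho> by (auto simp: field_simps)
  moreover have "t = 1 + \<rho> - \<rho> * s \<longleftrightarrow> t * b = (1 + \<rho>) * b - \<rho> * (s * b)"
  proof -
    have "(1 + \<rho>) * b - \<rho> * (s * b) = (1 + \<rho> - \<rho> * s) * b" by (simp add: algebra_simps)
    then show ?thesis using pos(1) by simp
  qed
  moreover have "s = \<rho> * t + (1 - \<rho>) \<longleftrightarrow> s * b = \<rho> * (t * b) + (1 - \<rho>) * b"
  proof -
    have "\<rho> * (t * b) + (1 - \<rho>) * b = (\<rho> * t + (1 - \<rho>)) * b" by (simp add: algebra_simps)
    then show ?thesis using pos(1) by simp
  qed
  ultimately show ?thesis
    unfolding os ot b_def[symmetric] S_star_def Let_def by auto
qed

section \<open>Attained values and the final equivalence\<close>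

lemma area_ratio_attains:
  assumes \<rho>: "0 < \<rho>" "\<rho> < 1"
    and v: "(1 - \<rho>) ^ 3 / (\<rho>\<^sup>2 - \<rho> + 1) < v" "v \<le> (1 - \<rho>)\<^sup>2 / (\<rho>\<^sup>2 + 1)"
  shows "\<exists>A B C D. convex_quad A B C D \<and> area_ratio \<rho> A B C D = v"
proof -
  \<comment> \<open>The ratio of a trapezoid with parallel sides \<open>z\<close> and
    \<open>1 - z\<close> and height 1. The formula extends to \<open>z = 0\<close>, where the
    trapezoid degenerates and \<open>g\<close> takes the lower bound.\<close>
  define g where "g z = 1 - 2 * \<rho> + \<rho> ^ 3 * cyclic_sum \<rho> (1 - z) z z (1 - z)" for z
  have "continuous_on {0..1/2} g"
    unfolding g_def cyclic_sum_def cevian_cross_def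
    by (intro continuous_intros ballI; fold cevian_cross_def)
       (use \<rho> in \<open>auto intro!: cevian_cross_pos less_imp_neq[THEN not_sym]\<close>)
  moreover have "g 0 \<le> v"
    using v(1) unfolding lower_bound_eq[OF \<rho>(1), symmetric] g_def
    by (simp add: cyclic_sum_def cevian_cross_def algebra_simps)
  \<comment> \<open>The parallelogram: all four areas agree, so the squared term in
    \<open>cyclic_sum_eq\<close> vanishes.\<close>
  moreover have "v \<le> g (1/2)"
    using v(2) cyclic_sum_eq[OF \<rho>, of "1/2" "1/2" "1/2" "1/2"]
    unfolding upper_bound_eq[symmetric] g_def by (simp add: field_simps)
  ultimately obtain z where z: "0 \<le> z" "z \<le> 1/2" "g z = v"
    using IVT'[of g 0 v "1/2"] by auto
  have "g 0 = (1 - \<rho>) ^ 3 / (\<rho>\<^sup>2 - \<rho> + 1)"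
    unfolding lower_bound_eq[OF \<rho>(1), symmetric] g_def
    by (simp add: cyclic_sum_def cevian_cross_def algebra_simps)
  \<comment> \<open>The strict inequality for \<open>v\<close> excludes the degenerate
    trapezoid.\<close>
  then have "z > 0" using z v(1) by (cases "z = 0") auto
  define A B C D :: point where
    "A = vector [0, 1]" "B = vector [0, 0]" "C = vector [z, 0]" "D = vector [1 - z, 1]"
  then have orients: "orient D A B = 1 - z" "orient A B C = z" "orient B C D = z" "orient C D A = 1 - z"
    by (simp_all add: orient_def algebra_simps)
  then have quad: "convex_quad A B C D" using z \<open>z > 0\<close> by (simp add: convex_quad_def)
  moreover have "area_ratio \<rho> A B C D = v"
    using area_ratio_eq[OF quad \<rho>] z(3) unfolding orients by (simp add: g_def)
  ultimately show ?thesis by blast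
qed

theorem theorem2:
  fixes \<rho> :: real
  assumes "0 < \<rho>" and "\<rho> < 1"
  shows "(\<forall>A B C D. convex_quad A B C D \<longrightarrow>
            ((\<forall>A' B' C' D'. convex_quad A' B' C' D' \<longrightarrow>
                area_ratio \<rho> A' B' C' D' \<le> area_ratio \<rho> A B C D)
             \<longleftrightarrow> D \<in> S_star \<rho> A B C))
         \<and> {area_ratio \<rho> A B C D | A B C D. convex_quad A B C D}
             = {(1 - \<rho>)^3 / (\<rho>^2 - \<rho> + 1) <.. (1 - \<rho>)^2 / (\<rho>^2 + 1)}"
proof
  let ?M = "(1 - \<rho>)\<^sup>2 / (\<rho>\<^sup>2 + 1)" and ?R = "{area_ratio \<rho> A B C D | A B C D. convex_quad A B C D}"
  show range: "?R = {(1 - \<rho>)^3 / (\<rho>^2 - \<rho> + 1) <.. ?M}"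
    using area_ratio_bounds(1,2)[OF _ assms] area_ratio_attains[OF assms] by fastforce
  \<comment> \<open>Any convex quadrilateral, here the unit square, shows that the interval is
    nonempty. Its right end is therefore attained, and being maximal means having ratio
    \<open>?M\<close>.\<close>
  have "convex_quad (vector [0, 1]) (vector [0, 0]) (vector [1, 0]) (vector [1, 1])"
    by (simp add: convex_quad_def orient_def)
  then have "(1 - \<rho>)^3 / (\<rho>^2 - \<rho> + 1) < ?M"
    using area_ratio_bounds(1,2)[OF _ assms] by (meson less_le_trans)
  then have "?M \<in> ?R" unfolding range by simp
  then obtain A0 B0 C0 D0 where max: "convex_quad A0 B0 C0 D0" "area_ratio \<rho> A0 B0 C0 D0 = ?M"
    by auto
  have "(\<forall>A' B' C' D'. convex_quad A' B' C' D' \<longrightarrow>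
        area_ratio \<rho> A' B' C' D' \<le> area_ratio \<rho> A B C D) \<longleftrightarrow> area_ratio \<rho> A B C D = ?M"
    if "convex_quad A B C D" for A B C D
  proof
    assume "\<forall>A' B' C' D'. convex_quad A' B' C' D' \<longrightarrow>
        area_ratio \<rho> A' B' C' D' \<le> area_ratio \<rho> A B C D"
    then have "?M \<le> area_ratio \<rho> A B C D" using max by metis
    then show "area_ratio \<rho> A B C D = ?M" using area_ratio_bounds(2)[OF that assms] by simp
  qed (use area_ratio_bounds(2)[OF _ assms] in simp)
  then show "\<forall>A B C D. convex_quad A B C D \<longrightarrow>
      ((\<forall>A' B' C' D'. convex_quad A' B' C' D' \<longrightarrow>
          area_ratio \<rho> A' B' C' D' \<le> area_ratio \<rho> A B C D) \<longleftrightarrow> D \<in> S_star \<rho> A B C)"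
    using area_ratio_bounds(3)[OF _ assms] S_star_iff[OF _ assms] by simp
qed

end
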